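(* For every constant $c>0$, the family of polytopes $\mathrm{P}_{\mathrm{match}}^{\ell}(n)$, where $n$ and $\ell$ range over all positive integers with $\ell\le c\log n$, has compact extended formulations.
   Context: $K_n=([n],E_n)$ is the complete graph on $[n]=\{1,\dots,n\}$. $\mathcal{M}^{\ell}(n)$ is the set of all matchings $M\subseteq E_n$ (sets of edges no two of which share a node) with $|M|=\ell$; $\chi(M)\in\{0,1\}^{E_n}$ is the characteristic vector of $M$; and $\mathrm{P}_{\mathrm{match}}^{\ell}(n)=\operatorname{conv}\{\chi(M): M\in\mathcal{M}^{\ell}(n)\}\subseteq\mathbb{R}^{E_n}$ (empty if $\ell>n/2$). An extension of a polytope $P\subseteq\mathbb{R}^m$ is a polyhedron $Q\subseteq\mathbb{R}^d$ together with an affine map $p:\mathbb{R}^d\to\mathbb{R}^m$ with $p(Q)=P$. An extended formulation for $P$ is a finite system of linear equations and inequalities whose solution set, together with some such map $p$, is an extension of $P$. Its size is its number of inequalities (including nonnegativity constraints, but not equations). Extended formulations for a family of polytopes $P\subseteq\mathbb{R}^m$ (varying $m$) are compact if their sizes and the encoding lengths of the coefficients needed to describe them are bounded by a polynomial in $m$ and the maximal encoding length of the components of the vertices of $P$. No symmetry is required. *)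

theory Defs
  imports
    "HOL-Analysis.Analysis"
    "HOL-Analysis.Finite_Function_Topology"
    "HOL-Library.Disjoint_Sets"
    "HOL-Computational_Algebra.Polynomial"
begin

text \<open>
  The space \<open>\<real>\<^sup>I\<close> for a finite index set \<open>I\<close> is modelled by the finitely supported functions with
  support in \<open>I\<close>. Since these form a \<^class>\<open>real_vector\<close>, the library notions
  \<^const>\<open>hull\<close>, \<^const>\<open>convex\<close> and \<^const>\<open>extreme_point_of\<close> apply, although the dimension is a value
  and not a type. The space \<open>\<real>\<^sup>d\<close> is the case \<open>I = {..<d}\<close>.
\<close>

definition coord_space :: "'i set \<Rightarrow> ('i \<Rightarrow>\<^sub>0 real) set" where
  "coord_space I = {x. Poly_Mapping.keys x \<subseteq> I}"


subsection \<open>Extended formulations\<close>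

text \<open>
  A pair \<open>(a, \<beta>)\<close> in \<open>ef_eqs\<close> stands for the equation \<open>a \<bullet> y = \<beta>\<close>, a pair in \<open>ef_ineqs\<close> for the
  inequality \<open>a \<bullet> y \<le> \<beta>\<close>. The last two fields are the matrix and the translation vector of the
  affine map \<open>\<real>\<^sup>d \<rightarrow> \<real>\<^sup>I\<close>, where \<open>d\<close> is \<open>ef_dim\<close>. Only entries with column indices below \<open>d\<close> and
  row indices in \<open>I\<close> are ever used.
\<close>

record 'i ext_form =
  ef_dim :: nat
  ef_eqs :: "((nat \<Rightarrow> real) \<times> real) list"
  ef_ineqs :: "((nat \<Rightarrow> real) \<times> real) list"
  ef_matrix :: "'i \<Rightarrow> nat \<Rightarrow> real"
  ef_offset :: "'i \<Rightarrow> real"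

definition lin_form :: "nat \<Rightarrow> (nat \<Rightarrow> real) \<Rightarrow> (nat \<Rightarrow>\<^sub>0 real) \<Rightarrow> real" where
  "lin_form d a y = (\<Sum>j<d. a j * Poly_Mapping.lookup y j)"

definition ef_polyhedron :: "'i ext_form \<Rightarrow> (nat \<Rightarrow>\<^sub>0 real) set" where
  "ef_polyhedron F =
     {y \<in> coord_space {..<ef_dim F}.
        (\<forall>(a, \<beta>) \<in> set (ef_eqs F). lin_form (ef_dim F) a y = \<beta>) \<and>
        (\<forall>(a, \<beta>) \<in> set (ef_ineqs F). lin_form (ef_dim F) a y \<le> \<beta>)}"

definition ef_map :: "'i set \<Rightarrow> 'i ext_form \<Rightarrow> (nat \<Rightarrow>\<^sub>0 real) \<Rightarrow> ('i \<Rightarrow>\<^sub>0 real)" where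
  "ef_map I F y =
     (\<Sum>i\<in>I. Poly_Mapping.single i (lin_form (ef_dim F) (ef_matrix F i) y + ef_offset F i))"

definition is_ext_form_of :: "'i ext_form \<Rightarrow> 'i set \<Rightarrow> ('i \<Rightarrow>\<^sub>0 real) set \<Rightarrow> bool" where
  "is_ext_form_of F I P \<longleftrightarrow> ef_map I F ` ef_polyhedron F = P"

definition ef_size :: "'i ext_form \<Rightarrow> nat" where
  "ef_size F = length (ef_ineqs F)"

definition ef_coeffs :: "'i set \<Rightarrow> 'i ext_form \<Rightarrow> real set" where
  "ef_coeffs I F =
     (\<Union>(a, \<beta>) \<in> set (ef_eqs F) \<union> set (ef_ineqs F). insert \<beta> (a ` {..<ef_dim F})) \<union>
     (\<Union>i\<in>I. insert (ef_offset F i) (ef_matrix F i ` {..<ef_dim F}))"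


subsection \<open>Encoding lengths and compactness\<close>

text \<open>
  The usual encoding length of a rational number \<open>p / q\<close> in lowest terms with \<open>q > 0\<close>. It is
  meaningful only for rational arguments.
\<close>

definition encoding_length :: "real \<Rightarrow> nat" where
  "encoding_length x =
     (let (p, q) = quotient_of (THE r. of_rat r = x)
      in 1 + nat \<lceil>log 2 (real_of_int \<bar>p\<bar> + 1)\<rceil> + nat \<lceil>log 2 (real_of_int q + 1)\<rceil>)"

text \<open>For the empty polytope, which has no vertices, the maximum is taken to be \<open>0\<close>.\<close>

definition vertex_encoding_length :: "'i set \<Rightarrow> ('i \<Rightarrow>\<^sub>0 real) set \<Rightarrow> nat" where
  "vertex_encoding_length I P =
     Max (insert 0 {encoding_length (Poly_Mapping.lookup v i) | v i. v extreme_point_of P \<and> i \<in> I})"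

text \<open>
  A family is a set of pairs \<open>(I, P)\<close> of a finite index set and a polytope \<open>P \<subseteq> \<real>\<^sup>I\<close>, so that the
  ambient dimension of \<open>P\<close> is \<open>card I\<close>. The bivariate polynomial is an element of \<open>\<real>[X][Y]\<close>,
  evaluated with the ambient dimension for \<open>X\<close> and the encoding length for \<open>Y\<close>.
\<close>

definition has_compact_ext_forms :: "('i set \<times> ('i \<Rightarrow>\<^sub>0 real) set) set \<Rightarrow> bool" where
  "has_compact_ext_forms \<P> \<longleftrightarrow>
     (\<exists>q :: real poly poly. \<forall>(I, P) \<in> \<P>.
        let bound = poly (poly q [:real (vertex_encoding_length I P):]) (real (card I))
        in \<exists>F. is_ext_form_of F I P \<and> real (ef_size F) \<le> bound \<and>
               (\<forall>a \<in> ef_coeffs I F. a \<in> \<rat> \<and> real (encoding_length a) \<le> bound))"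


subsection \<open>Cardinality-restricted matching polytopes\<close>

definition complete_edges :: "nat \<Rightarrow> nat set set" where
  "complete_edges n = {e. e \<subseteq> {1..n} \<and> card e = 2}"

definition matchings :: "nat \<Rightarrow> nat \<Rightarrow> nat set set set" where
  "matchings l n = {M. M \<subseteq> complete_edges n \<and> disjoint M \<and> card M = l}"

definition char_vec :: "'i set \<Rightarrow> ('i \<Rightarrow>\<^sub>0 real)" where
  "char_vec M = (\<Sum>e\<in>M. Poly_Mapping.single e 1)"

definition match_polytope :: "nat \<Rightarrow> nat \<Rightarrow> (nat set \<Rightarrow>\<^sub>0 real) set" where
  "match_polytope l n = convex hull (char_vec ` matchings l n)"

end

theory Submission
  imports Defs
begin

text \<open>
  Colour the nodes with \<open>2 l\<close> colours. Some colouring out of a family of at most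
  \<open>2 l * ln n * exp (2 l) + 1\<close> colourings separates all nodes covered by a given matching of size \<open>l\<close>
  (averaging argument). For a fixed colouring, adding edges one by one and remembering only the set of
  colours already used is a walk in a digraph on \<open>4 ^ l\<close> vertices. The polytope is therefore the
  convex hull of the label vectors of walks of length \<open>l\<close> in a digraph of size polynomial in \<open>n\<close> (as
  \<open>l \<le> c ln n\<close>), and by flow decomposition such a hull is a projection of a flow polytope.
\<close>

subsection \<open>Formulations in standard form\<close>

lemma lookup_sum_single:
  assumes "finite I"
  shows "Poly_Mapping.lookup (\<Sum>i\<in>I. Poly_Mapping.single i (f i)) k = (if k \<in> I then f k else 0)"
  using assms by (simp add: lookup_sum lookup_single when_def)

text \<open>This allows variables indexed by an arbitrary finite set, later by pairs (layer, arc).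
  Nonnegativity constraints are the only inequalities, which fixes the size; they and the zero
  offset contribute only -1 and 0 as coefficients.\<close>

lemma standard_form_ext_form:
  fixes A :: "'i \<Rightarrow> 'j \<Rightarrow> real" and E :: "(('j \<Rightarrow> real) \<times> real) set"
  assumes "finite J" "finite E"
  obtains F where
    "is_ext_form_of F I {\<Sum>i\<in>I. Poly_Mapping.single i (\<Sum>j\<in>J. A i j * y j) | y.
       (\<forall>j\<in>J. 0 \<le> y j) \<and> (\<forall>(a, \<beta>)\<in>E. (\<Sum>j\<in>J. a j * y j) = \<beta>)}"
    and "ef_size F = card J"
    and "ef_coeffs I F \<subseteq> {-1, 0} \<union> (\<Union>(a, \<beta>)\<in>E. insert \<beta> (a ` J)) \<union> (\<Union>i\<in>I. A i ` J)"
proof -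
  define d where "d = card J"
  obtain h where h: "bij_betw h {..<d} J"
    using ex_bij_betw_nat_finite[OF \<open>finite J\<close>] by (auto simp: d_def atLeast0LessThan)
  obtain L where L: "set L = E"
    using finite_list[OF \<open>finite E\<close>] by blast
  \<comment> \<open>\<open>h\<close> numbers the variables. Inequalities have the form
    \<open>a \<bullet> y \<le> \<beta>\<close>, so nonnegativity of the variable with number
    \<open>j\<close> is entered as \<open>- y j \<le> 0\<close>.\<close>
  define F :: "'i ext_form" where
    "F = \<lparr>ef_dim = d, ef_eqs = map (\<lambda>(a, \<beta>). (a \<circ> h, \<beta>)) L,
          ef_ineqs = map (\<lambda>j. (\<lambda>i. if i = j then -1 else 0, 0)) [0..<d],
          ef_matrix = (\<lambda>i. A i \<circ> h), ef_offset = (\<lambda>_. 0)\<rparr>"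
  have hJ: "h i \<in> J" if "i < d" for i
    using h that by (auto simp: bij_betw_def)
  have neg: "lin_form d (\<lambda>i. if i = j then -1 else 0) Y = - Poly_Mapping.lookup Y j" if "j < d" for j Y
  proof -
    have "lin_form d (\<lambda>i. if i = j then -1 else 0) Y
        = (\<Sum>i<d. if i = j then - Poly_Mapping.lookup Y i else 0)"
      unfolding lin_form_def by (rule sum.cong) auto
    then show ?thesis using that by simp
  qed
  have reindex: "lin_form d (a \<circ> h) Y = (\<Sum>j\<in>J. a j * y j)"
    if "\<And>i. i < d \<Longrightarrow> Poly_Mapping.lookup Y i = y (h i)" for a Y y
  proof -
    have "lin_form d (a \<circ> h) Y = (\<Sum>i<d. a (h i) * y (h i))"
      unfolding lin_form_def by (rule sum.cong) (auto simp: that)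
    also have "\<dots> = (\<Sum>j\<in>J. a j * y j)"
      by (rule sum.reindex_bij_betw[OF h])
    finally show ?thesis .
  qed
  have poly: "Y \<in> ef_polyhedron F \<longleftrightarrow> Y \<in> coord_space {..<d} \<and>
      (\<forall>(a, \<beta>)\<in>E. lin_form d (a \<circ> h) Y = \<beta>) \<and> (\<forall>j<d. 0 \<le> Poly_Mapping.lookup Y j)" for Y
    by (auto simp: ef_polyhedron_def F_def L neg split: prod.splits)
  have map_eq: "ef_map I F Y = (\<Sum>i\<in>I. Poly_Mapping.single i (\<Sum>j\<in>J. A i j * y j))"
    if "\<And>i. i < d \<Longrightarrow> Poly_Mapping.lookup Y i = y (h i)" for Y y
    unfolding ef_map_def F_def using reindex[OF that] by simp
  let ?P = "{\<Sum>i\<in>I. Poly_Mapping.single i (\<Sum>j\<in>J. A i j * y j) | y.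
       (\<forall>j\<in>J. 0 \<le> y j) \<and> (\<forall>(a, \<beta>)\<in>E. (\<Sum>j\<in>J. a j * y j) = \<beta>)}"
  have "ef_map I F ` ef_polyhedron F = ?P"
  proof (intro equalityI subsetI)
    fix x assume "x \<in> ef_map I F ` ef_polyhedron F"
    then obtain Y where Y: "Y \<in> ef_polyhedron F" "x = ef_map I F Y" by blast
    define y where "y j = Poly_Mapping.lookup Y (inv_into {..<d} h j)" for j
    have yh: "Poly_Mapping.lookup Y i = y (h i)" if "i < d" for i
      using that h by (simp add: y_def bij_betw_def)
    have "0 \<le> y j" if "j \<in> J" for j
    proof -
      obtain i where "i < d" "h i = j"
        using h \<open>j \<in> J\<close> unfolding bij_betw_def by blast
      then show ?thesis using Y(1) yh poly by metis
    qed
    moreover have "\<forall>(a, \<beta>)\<in>E. (\<Sum>j\<in>J. a j * y j) = \<beta>"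
      using Y(1) by (auto simp: poly reindex[OF yh])
    ultimately show "x \<in> ?P" using Y(2) map_eq[OF yh] by blast
  next
    fix x assume "x \<in> ?P"
    then obtain y where x: "x = (\<Sum>i\<in>I. Poly_Mapping.single i (\<Sum>j\<in>J. A i j * y j))"
      and nn: "\<forall>j\<in>J. 0 \<le> y j" and eq: "\<forall>(a, \<beta>)\<in>E. (\<Sum>j\<in>J. a j * y j) = \<beta>" by blast
    define Y where "Y = (\<Sum>i<d. Poly_Mapping.single i (y (h i)))"
    have lookup_Y: "Poly_Mapping.lookup Y i = (if i < d then y (h i) else 0)" for i
      by (simp add: Y_def lookup_sum_single)
    then have yh: "\<And>i. i < d \<Longrightarrow> Poly_Mapping.lookup Y i = y (h i)" by simp
    have "Y \<in> coord_space {..<d}"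
      by (auto simp: coord_space_def in_keys_iff lookup_Y split: if_splits)
    then have "Y \<in> ef_polyhedron F"
      using nn eq hJ by (simp add: poly reindex[OF yh] yh)
    moreover have "x = ef_map I F Y" by (simp add: x map_eq[OF yh])
    ultimately show "x \<in> ef_map I F ` ef_polyhedron F" by blast
  qed
  moreover have "ef_coeffs I F \<subseteq> {-1, 0} \<union> (\<Union>(a, \<beta>)\<in>E. insert \<beta> (a ` J)) \<union> (\<Union>i\<in>I. A i ` J)"
  proof -
    have "ef_coeffs I F = (\<Union>(a, \<beta>)\<in>E. insert \<beta> ((a \<circ> h) ` {..<d})) \<union>
        (\<Union>j<d. insert 0 ((\<lambda>i. if i = j then -1 else 0) ` {..<d})) \<union>
        (\<Union>i\<in>I. insert 0 ((A i \<circ> h) ` {..<d}))"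
      by (simp add: ef_coeffs_def F_def L UN_Un lessThan_atLeast0 case_prod_unfold)
    moreover have "(a \<circ> h) ` {..<d} = a ` J" for a :: "'j \<Rightarrow> real"
      using h by (metis bij_betw_imp_surj_on image_comp)
    moreover have "(\<Union>j<d. insert 0 ((\<lambda>i. if i = j then -1 else 0) ` {..<d})) \<subseteq> {-1, 0 :: real}"
      by auto
    ultimately show ?thesis by auto
  qed
  moreover have "ef_size F = card J"
    by (simp add: ef_size_def F_def d_def)
  ultimately show thesis
    by (intro that[of F]) (auto simp: is_ext_form_of_def)
qed

subsection \<open>Walks and flows\<close>

lemma lookup_scaleR: "Poly_Mapping.lookup (r *\<^sub>R x) i = r *\<^sub>R Poly_Mapping.lookup x i"
proof -
  have "finite {i. r *\<^sub>R Poly_Mapping.lookup x i \<noteq> 0}"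
    by (rule finite_subset[OF _ finite_lookup[of x]]) auto
  then show ?thesis
    by (simp add: scaleR_poly_mapping_def lookup_Abs_poly_mapping)
qed

locale labelled_digraph =
  fixes arcs :: "'a set" and src tgt :: "'a \<Rightarrow> 's" and lab :: "'a \<Rightarrow> 'e"
  assumes finite_arcs: "finite arcs"
begin

primrec walk :: "'s \<Rightarrow> 'a list \<Rightarrow> bool" where
  "walk v [] = True"
| "walk v (a # p) = (a \<in> arcs \<and> src a = v \<and> walk (tgt a) p)"

text \<open>Labels are counted with multiplicity, so this is a characteristic vector only when the
  labels along \<open>p\<close> are distinct.\<close>

definition walk_vec :: "'a list \<Rightarrow> 'e \<Rightarrow>\<^sub>0 real" where
  "walk_vec p = (\<Sum>a\<leftarrow>p. Poly_Mapping.single (lab a) 1)"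

definition walk_vecs :: "nat \<Rightarrow> 's \<Rightarrow> ('e \<Rightarrow>\<^sub>0 real) set" where
  "walk_vecs l v = {walk_vec p | p. walk v p \<and> length p = l}"

lemma walk_vecs_0: "walk_vecs 0 v = {0}"
  by (auto simp: walk_vecs_def walk_vec_def)

text \<open>Prepending the arc \<open>a\<close> translates all walk vectors by the same unit vector,
  and translations commute with convex hulls.\<close>

lemma walk_vecs_Suc:
  assumes "a \<in> arcs" "x \<in> convex hull walk_vecs l (tgt a)"
  shows "Poly_Mapping.single (lab a) 1 + x \<in> convex hull walk_vecs (Suc l) (src a)"
proof -
  let ?s = "Poly_Mapping.single (lab a) (1::real)"
  have "(+) ?s ` walk_vecs l (tgt a) \<subseteq> walk_vecs (Suc l) (src a)"
  proof clarify
    fix x assume "x \<in> walk_vecs l (tgt a)"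
    then obtain p where "x = walk_vec p" "walk (tgt a) p" "length p = l"
      by (auto simp: walk_vecs_def)
    then have "?s + x = walk_vec (a # p)" "walk (src a) (a # p)" "length (a # p) = Suc l"
      using assms(1) by (auto simp: walk_vec_def)
    then show "?s + x \<in> walk_vecs (Suc l) (src a)" unfolding walk_vecs_def by blast
  qed
  then have "convex hull ((+) ?s ` walk_vecs l (tgt a)) \<subseteq> convex hull walk_vecs (Suc l) (src a)"
    by (rule hull_mono)
  then show ?thesis
    using assms(2) by (auto simp: convex_hull_translation)
qed

lemma sum_group_by:
  fixes f :: "'a \<Rightarrow> 'b::comm_monoid_add"
  assumes "finite V" "g ` arcs \<subseteq> V"
  shows "(\<Sum>v\<in>V. \<Sum>a\<in>{a\<in>arcs. g a = v}. f a) = (\<Sum>a\<in>arcs. f a)"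
  by (rule sum.group[OF finite_arcs assms])

text \<open>Here \<open>\<mu> v\<close> is the supply at \<open>v\<close>, and \<open>x v\<close>
  averages the vectors of the walks along which this supply travels. The induction peels off the
  first layer. Averaging at \<open>v\<close> divides by \<open>\<mu> v\<close>, so nothing is
  claimed about \<open>x v\<close> where the supply vanishes.\<close>

lemma flow_decomposition:
  fixes y :: "nat \<Rightarrow> 'a \<Rightarrow> real" and \<mu> :: "'s \<Rightarrow> real"
  assumes "finite V" "src ` arcs \<subseteq> V" "tgt ` arcs \<subseteq> V"
    and "\<And>v. v \<in> V \<Longrightarrow> 0 \<le> \<mu> v"
    and "\<And>i a. i < l \<Longrightarrow> a \<in> arcs \<Longrightarrow> 0 \<le> y i a"
    and "\<And>v. 0 < l \<Longrightarrow> v \<in> V \<Longrightarrow> (\<Sum>a\<in>{a\<in>arcs. src a = v}. y 0 a) = \<mu> v"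
    and "\<And>i v. Suc i < l \<Longrightarrow> v \<in> V \<Longrightarrow>
      (\<Sum>a\<in>{a\<in>arcs. src a = v}. y (Suc i) a) = (\<Sum>a\<in>{a\<in>arcs. tgt a = v}. y i a)"
  shows "\<exists>x. (\<forall>v\<in>V. 0 < \<mu> v \<longrightarrow> x v \<in> convex hull walk_vecs l v) \<and>
    (\<Sum>i<l. \<Sum>a\<in>arcs. y i a *\<^sub>R Poly_Mapping.single (lab a) 1) = (\<Sum>v\<in>V. \<mu> v *\<^sub>R x v)"
  using assms(4-)
proof (induction l arbitrary: y \<mu>)
  case 0
  show ?case by (rule exI[of _ "\<lambda>_. 0"]) (simp add: walk_vecs_0)
next
  case (Suc l)
  \<comment> \<open>The amount that the first layer delivers to \<open>v\<close>. By flow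
    conservation it is the supply for the remaining \<open>l\<close> layers, to which the induction
    hypothesis applies.\<close>
  define \<nu> where "\<nu> v = (\<Sum>a\<in>{a\<in>arcs. tgt a = v}. y 0 a)" for v
  have "\<exists>x. (\<forall>v\<in>V. 0 < \<nu> v \<longrightarrow> x v \<in> convex hull walk_vecs l v) \<and>
    (\<Sum>i<l. \<Sum>a\<in>arcs. y (Suc i) a *\<^sub>R Poly_Mapping.single (lab a) 1) = (\<Sum>v\<in>V. \<nu> v *\<^sub>R x v)"
    using Suc.prems by (intro Suc.IH) (auto simp: \<nu>_def intro!: sum_nonneg)
  then obtain x where x: "\<And>v. v \<in> V \<Longrightarrow> 0 < \<nu> v \<Longrightarrow> x v \<in> convex hull walk_vecs l v"
    and sum_x: "(\<Sum>i<l. \<Sum>a\<in>arcs. y (Suc i) a *\<^sub>R Poly_Mapping.single (lab a) 1) = (\<Sum>v\<in>V. \<nu> v *\<^sub>R x v)"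
    by blast
  define u where "u a = Poly_Mapping.single (lab a) 1 + x (tgt a)" for a
  \<comment> \<open>The weight \<open>y 0 a / \<mu> v\<close> is the share of the supply at
    \<open>v\<close> that leaves through \<open>a\<close>; from there it continues with the average
    \<open>x (tgt a)\<close>.\<close>
  define z where "z v = (\<Sum>a\<in>{a\<in>arcs. src a = v}. (y 0 a / \<mu> v) *\<^sub>R u a)" for v
  have "z v \<in> convex hull walk_vecs (Suc l) v" if "v \<in> V" "0 < \<mu> v" for v
  proof -
    \<comment> \<open>Arcs without flow are discarded: only an arc with positive flow guarantees
      \<open>0 < \<nu> (tgt a)\<close>, and hence that \<open>x (tgt a)\<close> lies in the
      hull.\<close>
    let ?D = "{a\<in>arcs. src a = v}" and ?S = "{a\<in>arcs. src a = v \<and> y 0 a \<noteq> 0}"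
    have "z v = (\<Sum>a\<in>?S. (y 0 a / \<mu> v) *\<^sub>R u a)"
      unfolding z_def using finite_arcs by (intro sum.mono_neutral_right) auto
    moreover have "(\<Sum>a\<in>?S. y 0 a / \<mu> v) = (\<Sum>a\<in>?D. y 0 a / \<mu> v)"
      using finite_arcs by (intro sum.mono_neutral_left) auto
    then have "(\<Sum>a\<in>?S. y 0 a / \<mu> v) = 1"
      using Suc.prems(3)[of v] that by (simp flip: sum_divide_distrib)
    moreover have "u a \<in> convex hull walk_vecs (Suc l) v" if a: "a \<in> ?S" for a
    proof -
      have "0 < y 0 a" using a Suc.prems(2)[of 0 a] by auto
      also have "y 0 a \<le> \<nu> (tgt a)"
        unfolding \<nu>_def using a finite_arcs Suc.prems(2) by (intro member_le_sum) auto
      finally have "x (tgt a) \<in> convex hull walk_vecs l (tgt a)"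
        using a assms(3) by (intro x) auto
      then show ?thesis using a walk_vecs_Suc[of a "x (tgt a)" l] by (auto simp: u_def)
    qed
    ultimately show ?thesis
      using finite_arcs Suc.prems(2) that
      by (auto intro!: convex_sum[OF _ convex_convex_hull])
  qed
  moreover have "(\<Sum>i<Suc l. \<Sum>a\<in>arcs. y i a *\<^sub>R Poly_Mapping.single (lab a) 1) = (\<Sum>v\<in>V. \<mu> v *\<^sub>R z v)"
  proof -
    have "(\<Sum>v\<in>V. \<nu> v *\<^sub>R x v) = (\<Sum>v\<in>V. \<Sum>a\<in>{a\<in>arcs. tgt a = v}. y 0 a *\<^sub>R x (tgt a))"
      by (simp add: \<nu>_def scaleR_left.sum)
    also have "\<dots> = (\<Sum>a\<in>arcs. y 0 a *\<^sub>R x (tgt a))"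
      by (rule sum_group_by[OF assms(1,3)])
    finally have "(\<Sum>i<Suc l. \<Sum>a\<in>arcs. y i a *\<^sub>R Poly_Mapping.single (lab a) 1)
        = (\<Sum>a\<in>arcs. y 0 a *\<^sub>R u a)"
      unfolding sum.lessThan_Suc_shift sum_x by (simp add: u_def scaleR_right_distrib sum.distrib)
    also have "\<dots> = (\<Sum>v\<in>V. \<Sum>a\<in>{a\<in>arcs. src a = v}. y 0 a *\<^sub>R u a)"
      by (rule sum_group_by[OF assms(1,2), symmetric])
    also have "\<dots> = (\<Sum>v\<in>V. \<mu> v *\<^sub>R z v)"
    proof (rule sum.cong)
      fix v assume v: "v \<in> V"
      show "(\<Sum>a\<in>{a\<in>arcs. src a = v}. y 0 a *\<^sub>R u a) = \<mu> v *\<^sub>R z v"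
      proof (cases "\<mu> v = 0")
        \<comment> \<open>Nonnegative outflows with total 0 all vanish, so both sides are 0 whatever
          \<open>z v\<close> is.\<close>
        case True
        have "\<forall>a\<in>{a\<in>arcs. src a = v}. y 0 a = 0"
          using Suc.prems(2,3) v True finite_arcs by (subst sum_nonneg_eq_0_iff[symmetric]) auto
        then show ?thesis using True by simp
      next
        case False
        then show ?thesis by (simp add: z_def scaleR_sum_right)
      qed
    qed simp
    finally show ?thesis .
  qed
  ultimately show ?case by blast
qed

lemma walk_tgt_src:
  assumes "walk v p" "Suc i < length p"
  shows "tgt (p ! i) = src (p ! Suc i)"
  using assms
proof (induction p arbitrary: v i)
  case (Cons a p)
  show ?case
  proof (cases i)
    case 0
    then show ?thesis using Cons.prems by (cases p) auto
  next
    case (Suc j)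
    then show ?thesis using Cons.prems Cons.IH[of "tgt a" j] by simp
  qed
qed simp

lemma walk_arcs: "walk v p \<Longrightarrow> set p \<subseteq> arcs"
  by (induction p arbitrary: v) auto

text \<open>
  The polytope is described as the set of unit flows from \<open>A\<close> through \<open>l\<close> consecutive copies of the
  digraph, where the variable \<open>(i, a)\<close> is the flow on the copy of \<open>a\<close> in layer \<open>i\<close>.
\<close>

theorem walk_polytope_ext_form:
  assumes "finite E" "lab ` arcs \<subseteq> E" "0 < l"
  obtains F where "is_ext_form_of F E (convex hull (\<Union>v\<in>A. walk_vecs l v))"
    and "ef_size F = l * card arcs"
    and "ef_coeffs E F \<subseteq> {-1, 0, 1}"
proof -
  define J where "J = {..<l} \<times> arcs"
  define V where "V = src ` arcs \<union> tgt ` arcs"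
  have [simp]: "finite J" "finite V"
    using finite_arcs by (auto simp: J_def V_def)
  \<comment> \<open>As a linear form, \<open>row i P\<close> measures the total flow in layer
    \<open>i\<close> on arcs satisfying \<open>P\<close>; \<open>cons i v\<close> is the outflow of
    \<open>v\<close> in layer \<open>i + 1\<close> minus its inflow in layer
    \<open>i\<close>.\<close>
  define row :: "nat \<Rightarrow> ('a \<Rightarrow> bool) \<Rightarrow> nat \<times> 'a \<Rightarrow> real"
    where "row i P = (\<lambda>(j, a). of_bool (j = i \<and> P a))" for i P
  define cons where "cons i v = (\<lambda>ja. row (Suc i) (\<lambda>a. src a = v) ja - row i (\<lambda>a. tgt a = v) ja)"
    for i :: nat and v :: 's
  \<comment> \<open>One unit starts in \<open>A\<close>, and with nonnegativity the second equation
    stops any flow from starting elsewhere. Conservation links consecutive layers, hence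
    \<open>l - 1\<close> values of \<open>i\<close>.\<close>
  define Eqs :: "((nat \<times> 'a \<Rightarrow> real) \<times> real) set" where
    "Eqs = {(row 0 (\<lambda>a. src a \<in> A), 1), (row 0 (\<lambda>a. src a \<notin> A), 0)} \<union>
       (\<lambda>(i, v). (cons i v, 0)) ` ({..<l - 1} \<times> V)"
  define B :: "'e \<Rightarrow> nat \<times> 'a \<Rightarrow> real" where "B e = (\<lambda>(i, a). of_bool (lab a = e))" for e
  have finite_Eqs: "finite Eqs" by (simp add: Eqs_def)
  obtain F where F: "is_ext_form_of F E {\<Sum>e\<in>E. Poly_Mapping.single e (\<Sum>j\<in>J. B e j * y j) | y.
       (\<forall>j\<in>J. 0 \<le> y j) \<and> (\<forall>(a, \<beta>)\<in>Eqs. (\<Sum>j\<in>J. a j * y j) = \<beta>)}" (is "is_ext_form_of F E ?P")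
    and size: "ef_size F = card J"
    and coeffs: "ef_coeffs E F \<subseteq> {-1, 0} \<union> (\<Union>(a, \<beta>)\<in>Eqs. insert \<beta> (a ` J)) \<union> (\<Union>e\<in>E. B e ` J)"
    by (rule standard_form_ext_form[OF \<open>finite J\<close> finite_Eqs, of E B]) (rule that)
  have row_sum: "(\<Sum>j\<in>J. row i P j * y j) = (\<Sum>a\<in>{a\<in>arcs. P a}. y (i, a))" if "i < l" for i P y
  proof -
    have "(\<Sum>j\<in>J. row i P j * y j) = (\<Sum>j\<in>Pair i ` {a\<in>arcs. P a}. row i P j * y j)"
      using finite_arcs that by (intro sum.mono_neutral_right) (auto simp: J_def row_def)
    also have "\<dots> = (\<Sum>a\<in>{a\<in>arcs. P a}. y (i, a))"
      by (subst sum.reindex) (auto simp: row_def inj_on_def intro!: sum.cong)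
    finally show ?thesis .
  qed
  have eqs_iff: "(\<forall>(a, \<beta>)\<in>Eqs. (\<Sum>j\<in>J. a j * y j) = \<beta>) \<longleftrightarrow>
      (\<Sum>a\<in>{a\<in>arcs. src a \<in> A}. y (0, a)) = 1 \<and> (\<Sum>a\<in>{a\<in>arcs. src a \<notin> A}. y (0, a)) = 0 \<and>
      (\<forall>i v. Suc i < l \<longrightarrow> v \<in> V \<longrightarrow>
        (\<Sum>a\<in>{a\<in>arcs. src a = v}. y (Suc i, a)) = (\<Sum>a\<in>{a\<in>arcs. tgt a = v}. y (i, a)))" for y
  proof -
    have "i < l - 1 \<longleftrightarrow> Suc i < l" for i by auto
    moreover have "(\<Sum>j\<in>J. cons i v j * y j) =
        (\<Sum>a\<in>{a\<in>arcs. src a = v}. y (Suc i, a)) - (\<Sum>a\<in>{a\<in>arcs. tgt a = v}. y (i, a))"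
      if "Suc i < l" for i v
      using that by (simp add: cons_def left_diff_distrib sum_subtractf row_sum)
    ultimately show ?thesis
      using \<open>0 < l\<close> by (auto simp: Eqs_def row_sum)
  qed
  have proj: "(\<Sum>e\<in>E. Poly_Mapping.single e (\<Sum>j\<in>J. B e j * y j))
      = (\<Sum>i<l. \<Sum>a\<in>arcs. y (i, a) *\<^sub>R Poly_Mapping.single (lab a) 1)" for y :: "nat \<times> 'a \<Rightarrow> real"
  proof -
    have "(\<Sum>e\<in>E. Poly_Mapping.single e (\<Sum>j\<in>J. B e j * y j))
        = (\<Sum>e\<in>E. \<Sum>j\<in>J. Poly_Mapping.single e (B e j * y j))"
      by (intro sum.cong refl poly_mapping_eqI) (simp add: lookup_sum lookup_single when_def)
    also have "\<dots> = (\<Sum>j\<in>J. \<Sum>e\<in>E. Poly_Mapping.single e (B e j * y j))"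
      by (rule sum.swap)
    also have "\<dots> = (\<Sum>j\<in>J. y j *\<^sub>R Poly_Mapping.single (lab (snd j)) 1)"
    proof (intro sum.cong refl poly_mapping_eqI)
      fix j e assume "j \<in> J"
      then have "lab (snd j) \<in> E" using assms(2) by (auto simp: J_def)
      then show "Poly_Mapping.lookup (\<Sum>e\<in>E. Poly_Mapping.single e (B e j * y j)) e =
          Poly_Mapping.lookup (y j *\<^sub>R Poly_Mapping.single (lab (snd j)) 1) e"
        using assms(1)
        by (auto simp: lookup_sum_single B_def lookup_scaleR lookup_single when_def split: prod.splits)
    qed
    also have "\<dots> = (\<Sum>i<l. \<Sum>a\<in>arcs. y (i, a) *\<^sub>R Poly_Mapping.single (lab a) 1)"
      by (simp add: J_def sum.cartesian_product case_prod_unfold)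
    finally show ?thesis .
  qed
  define Q where "Q y \<longleftrightarrow> (\<forall>j\<in>J. 0 \<le> y j) \<and> (\<forall>(a, \<beta>)\<in>Eqs. (\<Sum>j\<in>J. a j * y j) = \<beta>)" for y
  have P_eq: "?P = {\<Sum>i<l. \<Sum>a\<in>arcs. y (i, a) *\<^sub>R Poly_Mapping.single (lab a) 1 | y. Q y}"
    by (simp add: proj Q_def)
  have "?P \<subseteq> convex hull (\<Union>v\<in>A. walk_vecs l v)"
  proof
    fix z assume "z \<in> ?P"
    then obtain y where z: "z = (\<Sum>i<l. \<Sum>a\<in>arcs. y (i, a) *\<^sub>R Poly_Mapping.single (lab a) 1)"
      and y: "Q y" unfolding P_eq by blast
    have nn: "\<And>i a. i < l \<Longrightarrow> a \<in> arcs \<Longrightarrow> 0 \<le> y (i, a)"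
      using y by (auto simp: Q_def J_def)
    have init: "(\<Sum>a\<in>{a\<in>arcs. src a \<in> A}. y (0, a)) = 1" "(\<Sum>a\<in>{a\<in>arcs. src a \<notin> A}. y (0, a)) = 0"
      and flow: "\<And>i v. Suc i < l \<Longrightarrow> v \<in> V \<Longrightarrow>
        (\<Sum>a\<in>{a\<in>arcs. src a = v}. y (Suc i, a)) = (\<Sum>a\<in>{a\<in>arcs. tgt a = v}. y (i, a))"
      using y by (auto simp: Q_def eqs_iff)
    define \<mu> where "\<mu> v = (\<Sum>a\<in>{a\<in>arcs. src a = v}. y (0, a))" for v
    have \<mu>_nn: "0 \<le> \<mu> v" for v
      unfolding \<mu>_def by (rule sum_nonneg) (auto simp: nn \<open>0 < l\<close>)
    have "\<exists>x. (\<forall>v\<in>V. 0 < \<mu> v \<longrightarrow> x v \<in> convex hull walk_vecs l v) \<and>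
      (\<Sum>i<l. \<Sum>a\<in>arcs. y (i, a) *\<^sub>R Poly_Mapping.single (lab a) 1) = (\<Sum>v\<in>V. \<mu> v *\<^sub>R x v)"
    proof (rule flow_decomposition[where y = "\<lambda>i a. y (i, a)"])
      show "finite V" by fact
      show "src ` arcs \<subseteq> V" "tgt ` arcs \<subseteq> V" by (auto simp: V_def)
    qed (use \<mu>_nn nn flow in \<open>simp_all add: \<mu>_def\<close>)
    then obtain x where x: "\<And>v. v \<in> V \<Longrightarrow> 0 < \<mu> v \<Longrightarrow> x v \<in> convex hull walk_vecs l v"
      and z': "z = (\<Sum>v\<in>V. \<mu> v *\<^sub>R x v)" unfolding z by blast
    have "y (0, a) = 0" if "a \<in> arcs" "src a \<notin> A" for a
      using init(2) that nn \<open>0 < l\<close> finite_arcs by (subst (asm) sum_nonneg_eq_0_iff) auto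
    then have \<mu>_0: "\<mu> v = 0" if "v \<notin> A" for v
      unfolding \<mu>_def using that by (intro sum.neutral) auto
    have "(\<Sum>v\<in>V. \<mu> v) = (\<Sum>a\<in>arcs. y (0, a))"
      unfolding \<mu>_def by (rule sum_group_by[OF \<open>finite V\<close>]) (auto simp: V_def)
    also have "\<dots> = (\<Sum>a\<in>{a\<in>arcs. src a \<in> A}. y (0, a)) + (\<Sum>a\<in>{a\<in>arcs. src a \<notin> A}. y (0, a))"
      using finite_arcs by (subst sum.union_disjoint[symmetric]) (auto intro!: sum.cong)
    finally have "(\<Sum>v\<in>V. \<mu> v) = 1" using init by simp
    \<comment> \<open>On \<open>W\<close> the points \<open>x v\<close> are known to lie in the
      hulls, and the \<open>\<mu> v\<close> are convex weights, since all of the unit flow starts in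
      \<open>A\<close>.\<close>
    define W where "W = {v\<in>V. \<mu> v \<noteq> 0}"
    have "z = (\<Sum>v\<in>W. \<mu> v *\<^sub>R x v)"
      unfolding z' W_def by (intro sum.mono_neutral_right) auto
    moreover have "(\<Sum>v\<in>W. \<mu> v) = 1"
      unfolding \<open>(\<Sum>v\<in>V. \<mu> v) = 1\<close>[symmetric] W_def by (intro sum.mono_neutral_left) auto
    moreover have "x v \<in> convex hull (\<Union>v\<in>A. walk_vecs l v)" if "v \<in> W" for v
    proof -
      have "v \<in> A" "0 < \<mu> v" "v \<in> V"
        using that \<mu>_0[of v] \<mu>_nn[of v] by (auto simp: W_def)
      moreover from this have "convex hull walk_vecs l v \<subseteq> convex hull (\<Union>v\<in>A. walk_vecs l v)"
        by (intro hull_mono) auto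
      ultimately show ?thesis using x by auto
    qed
    moreover have "finite W" by (simp add: W_def)
    ultimately show "z \<in> convex hull (\<Union>v\<in>A. walk_vecs l v)"
      by (simp add: convex_sum[OF _ convex_convex_hull] \<mu>_nn)
  qed
  \<comment> \<open>The constraints \<open>Q\<close> survive convex combinations and the projection
    is linear in \<open>y\<close>, so it suffices to find a feasible flow for each single
    walk.\<close>
  moreover have "convex hull (\<Union>v\<in>A. walk_vecs l v) \<subseteq> ?P"
  proof (rule hull_minimal)
    show "convex ?P"
      unfolding P_eq
    proof (rule convexI, clarify)
      fix y y' and u w :: real assume "Q y" "Q y'" "0 \<le> u" "0 \<le> w" "u + w = 1"
      let ?y = "\<lambda>j. u * y j + w * y' j"
      have "(\<Sum>j\<in>J. a j * ?y j) = u * (\<Sum>j\<in>J. a j * y j) + w * (\<Sum>j\<in>J. a j * y' j)" for a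
        by (simp add: sum_distrib_left sum.distrib algebra_simps)
      moreover have "u * \<beta> + w * \<beta> = \<beta>" for \<beta>
        using \<open>u + w = 1\<close> by (metis distrib_right mult_1)
      ultimately have "Q ?y"
        using \<open>Q y\<close> \<open>Q y'\<close> \<open>0 \<le> u\<close> \<open>0 \<le> w\<close> by (fastforce simp: Q_def)
      moreover have "u *\<^sub>R (\<Sum>i<l. \<Sum>a\<in>arcs. y (i, a) *\<^sub>R Poly_Mapping.single (lab a) (1::real))
          + w *\<^sub>R (\<Sum>i<l. \<Sum>a\<in>arcs. y' (i, a) *\<^sub>R Poly_Mapping.single (lab a) 1)
          = (\<Sum>i<l. \<Sum>a\<in>arcs. ?y (i, a) *\<^sub>R Poly_Mapping.single (lab a) 1)"
        by (simp add: scaleR_sum_right sum.distrib scaleR_left_distrib)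
      ultimately show "\<exists>y''. u *\<^sub>R (\<Sum>i<l. \<Sum>a\<in>arcs. y (i, a) *\<^sub>R Poly_Mapping.single (lab a) (1::real))
          + w *\<^sub>R (\<Sum>i<l. \<Sum>a\<in>arcs. y' (i, a) *\<^sub>R Poly_Mapping.single (lab a) 1)
          = (\<Sum>i<l. \<Sum>a\<in>arcs. y'' (i, a) *\<^sub>R Poly_Mapping.single (lab a) 1) \<and> Q y''"
        by (intro exI[of _ ?y] conjI)
    qed
    show "(\<Union>v\<in>A. walk_vecs l v) \<subseteq> ?P"
    proof
      fix x assume "x \<in> (\<Union>v\<in>A. walk_vecs l v)"
      then obtain v p where "v \<in> A" and p: "walk v p" "length p = l" "x = walk_vec p"
        by (auto simp: walk_vecs_def)
      have p_arcs: "p ! i \<in> arcs" if "i < l" for i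
        using walk_arcs[OF p(1)] p(2) that by (meson nth_mem subsetD)
      have p_0: "src (p ! 0) = v" using p \<open>0 < l\<close> by (cases p) auto
      \<comment> \<open>One unit of flow follows the walk: in layer \<open>i\<close> it uses exactly
        the arc \<open>p ! i\<close>.\<close>
      define y :: "nat \<times> 'a \<Rightarrow> real" where "y = (\<lambda>(i, a). of_bool (a = p ! i))"
      have y_sum: "(\<Sum>a\<in>{a\<in>arcs. R a}. y (i, a)) = of_bool (R (p ! i))" if "i < l" for i R
        using finite_arcs p_arcs[OF that] by (simp add: y_def of_bool_def)
      have "Q y"
        unfolding Q_def eqs_iff using \<open>0 < l\<close> \<open>v \<in> A\<close> p
        by (auto simp: y_sum p_0 walk_tgt_src) (auto simp: y_def)
      moreover have "x = (\<Sum>i<l. \<Sum>a\<in>arcs. y (i, a) *\<^sub>R Poly_Mapping.single (lab a) 1)"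
      proof -
        have "(\<Sum>a\<in>arcs. y (i, a) *\<^sub>R Poly_Mapping.single (lab a) (1::real)) =
            Poly_Mapping.single (lab (p ! i)) 1" if "i < l" for i
        proof -
          have "(\<Sum>a\<in>arcs. y (i, a) *\<^sub>R Poly_Mapping.single (lab a) (1::real)) =
              (\<Sum>a\<in>arcs. if a = p ! i then Poly_Mapping.single (lab a) 1 else 0)"
            by (rule sum.cong) (auto simp: y_def)
          then show ?thesis using finite_arcs p_arcs[OF that] by simp
        qed
        then show ?thesis
          by (simp add: p walk_vec_def sum_list_sum_nth atLeast0LessThan)
      qed
      ultimately show "x \<in> ?P" unfolding P_eq by blast
    qed
  qed
  ultimately have P_hull: "?P = convex hull (\<Union>v\<in>A. walk_vecs l v)" by (rule equalityI)
  have "ef_coeffs E F \<subseteq> {-1, 0, 1}"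
    by (rule order_trans[OF coeffs]) (auto simp: Eqs_def row_def cons_def B_def)
  moreover have "ef_size F = l * card arcs"
    by (simp add: size J_def card_cartesian_product)
  ultimately show thesis
    using F unfolding P_hull by (intro that[of F])
qed

end

subsection \<open>Perfect hash families\<close>

text \<open>The quotient \<open>k ^ k / fact k\<close> is a single term of the exponential series at
  \<open>k\<close>, all of whose terms are nonnegative.\<close>

lemma power_le_exp_mult_fact: "real k ^ k \<le> exp (real k) * fact k"
proof -
  have "real k ^ k / fact k \<le> exp (real k)"
    using sum_le_suminf[of "\<lambda>n. real k ^ n /\<^sub>R fact n" "{k}"] summable_exp_generic[of "real k"]
    by (simp add: exp_def field_simps)
  then show ?thesis by (simp add: field_simps)
qed

text \<open>A colouring is injective on \<open>W\<close> in \<open>fact k\<close> of the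
  \<open>k ^ k\<close> ways to colour \<open>W\<close>, while the other elements are coloured
  freely. The fraction \<open>fact k / k ^ k\<close> is at least \<open>exp (- k)\<close>.\<close>

lemma card_colourings_inj_on:
  assumes "finite X" "W \<subseteq> X" "card W = k"
  shows "exp (- real k) * real (card (X \<rightarrow>\<^sub>E {..<k})) \<le> real (card {\<phi> \<in> X \<rightarrow>\<^sub>E {..<k}. inj_on \<phi> W})"
proof -
  have "card W \<le> card X" using assms by (intro card_mono)
  have "prod ((-) k) {0..<k} = (fact k :: nat)"
    by (simp add: fact_prod_rev)
  then have "card {\<phi> \<in> X \<rightarrow>\<^sub>E {..<k}. inj_on \<phi> W} = k ^ (card X - k) * fact k"
    using card_inj_on_subset_funcset[of X "{..<k}" W] assms by simp
  moreover have "card (X \<rightarrow>\<^sub>E {..<k}) = k ^ (card X - k) * k ^ k"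
    using \<open>card W \<le> card X\<close> assms by (simp add: card_funcsetE flip: power_add)
  moreover have "exp (- real k) * real k ^ k \<le> fact k"
    using power_le_exp_mult_fact[of k] by (simp add: exp_minus field_simps)
  then have "real (k ^ (card X - k)) * (exp (- real k) * real k ^ k) \<le> real (k ^ (card X - k)) * fact k"
    by (rule mult_left_mono) simp
  ultimately show ?thesis by (simp add: mult.left_commute)
qed

lemma ex_colouring_separating_fraction:
  assumes "finite X" "finite \<W>" "0 < k" and W: "\<And>W. W \<in> \<W> \<Longrightarrow> W \<subseteq> X \<and> card W = k"
  shows "\<exists>\<phi>\<in>X \<rightarrow>\<^sub>E {..<k}. real (card {W\<in>\<W>. \<not> inj_on \<phi> W}) \<le> (1 - exp (- real k)) * real (card \<W>)"
proof (rule ccontr)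
  let ?C = "X \<rightarrow>\<^sub>E {..<k}" and ?p = "exp (- real k)"
  \<comment> \<open>Otherwise the average over all colourings of the number of separated sets would be too small.\<close>
  have [simp]: "finite ?C" using assms by (simp add: finite_PiE)
  have "card ?C > 0" using assms by (simp add: card_funcsetE)
  then have "?C \<noteq> {}" by force
  assume contr: "\<not> ?thesis"
  have "card {W\<in>\<W>. inj_on \<phi> W} < ?p * card \<W>" if "\<phi> \<in> ?C" for \<phi>
  proof -
    have "card \<W> = card {W\<in>\<W>. inj_on \<phi> W} + card {W\<in>\<W>. \<not> inj_on \<phi> W}"
      using \<open>finite \<W>\<close> by (subst card_Un_disjoint[symmetric]) (auto intro: arg_cong[of _ _ card])
    moreover have "(1 - ?p) * card \<W> < card {W\<in>\<W>. \<not> inj_on \<phi> W}"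
      using contr that by auto
    ultimately show ?thesis by (simp add: left_diff_distrib)
  qed
  then have "(\<Sum>\<phi>\<in>?C. real (card {W\<in>\<W>. inj_on \<phi> W})) < (\<Sum>\<phi>\<in>?C. ?p * card \<W>)"
    using \<open>?C \<noteq> {}\<close> by (intro sum_strict_mono) auto
  also have "\<dots> = (\<Sum>W\<in>\<W>. ?p * card ?C)"
    by simp
  also have "\<dots> \<le> (\<Sum>W\<in>\<W>. real (card {\<phi>\<in>?C. inj_on \<phi> W}))"
    using W assms(1) by (intro sum_mono card_colourings_inj_on) auto
  also have "\<dots> = (\<Sum>\<phi>\<in>?C. real (card {W\<in>\<W>. inj_on \<phi> W}))"
  proof -
    have "(\<Sum>W\<in>\<W>. card {\<phi>\<in>?C. inj_on \<phi> W}) = (\<Sum>\<phi>\<in>?C. card {W\<in>\<W>. inj_on \<phi> W})"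
      using \<open>finite \<W>\<close> by (intro sum_multicount_gen) auto
    then show ?thesis by (simp flip: of_nat_sum)
  qed
  finally show False by simp
qed

text \<open>Greedy choice: each new colouring is taken for the sets not yet separated and shrinks
  their number by the factor \<open>1 - exp (- k)\<close>.\<close>

lemma ex_colourings_separating:
  assumes "finite X" "finite \<W>" "0 < k" "\<And>W. W \<in> \<W> \<Longrightarrow> W \<subseteq> X \<and> card W = k"
  shows "\<exists>\<Phi> \<subseteq> X \<rightarrow>\<^sub>E {..<k}. finite \<Phi> \<and> card \<Phi> \<le> t \<and>
    real (card {W\<in>\<W>. \<forall>\<phi>\<in>\<Phi>. \<not> inj_on \<phi> W}) \<le> (1 - exp (- real k)) ^ t * real (card \<W>)"
proof (induction t)
  case 0
  show ?case by (rule exI[of _ "{}"]) simp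
next
  case (Suc t)
  then obtain \<Phi> where \<Phi>: "\<Phi> \<subseteq> X \<rightarrow>\<^sub>E {..<k}" "finite \<Phi>" "card \<Phi> \<le> t"
    "real (card {W\<in>\<W>. \<forall>\<phi>\<in>\<Phi>. \<not> inj_on \<phi> W}) \<le> (1 - exp (- real k)) ^ t * real (card \<W>)"
    by blast
  let ?R = "{W\<in>\<W>. \<forall>\<phi>\<in>\<Phi>. \<not> inj_on \<phi> W}"
  obtain \<psi> where \<psi>: "\<psi> \<in> X \<rightarrow>\<^sub>E {..<k}"
    "real (card {W\<in>?R. \<not> inj_on \<psi> W}) \<le> (1 - exp (- real k)) * real (card ?R)"
    using ex_colouring_separating_fraction[of X ?R k] assms by auto
  have "{W\<in>?R. \<not> inj_on \<psi> W} = {W\<in>\<W>. \<forall>\<phi>\<in>insert \<psi> \<Phi>. \<not> inj_on \<phi> W}" by auto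
  moreover have "(1 - exp (- real k)) * real (card ?R) \<le> (1 - exp (- real k)) ^ Suc t * real (card \<W>)"
    using mult_left_mono[OF \<Phi>(4), of "1 - exp (- real k)"] by (simp add: mult.assoc)
  ultimately have "real (card {W\<in>\<W>. \<forall>\<phi>\<in>insert \<psi> \<Phi>. \<not> inj_on \<phi> W})
      \<le> (1 - exp (- real k)) ^ Suc t * real (card \<W>)"
    using \<psi>(2) by simp
  moreover have "insert \<psi> \<Phi> \<subseteq> X \<rightarrow>\<^sub>E {..<k}" "finite (insert \<psi> \<Phi>)"
    using \<Phi>(1,2) \<psi>(1) by blast+
  moreover have "card (insert \<psi> \<Phi>) \<le> Suc t"
    using \<Phi>(2,3) by (simp add: card_insert_if)
  ultimately show ?case by (intro exI[of _ "insert \<psi> \<Phi>"] conjI)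
qed

definition perfect_hash_family :: "nat \<Rightarrow> nat set \<Rightarrow> (nat \<Rightarrow> nat) set \<Rightarrow> bool" where
  "perfect_hash_family k X \<Phi> \<longleftrightarrow> finite \<Phi> \<and> \<Phi> \<subseteq> X \<rightarrow>\<^sub>E {..<k} \<and>
     (\<forall>W \<subseteq> X. card W = k \<longrightarrow> (\<exists>\<phi>\<in>\<Phi>. inj_on \<phi> W))"

text \<open>There are at most \<open>card X ^ k\<close> sets to separate. The bound on
  \<open>t\<close> makes the number left after \<open>t\<close> greedy rounds smaller than 1, hence
  0.\<close>

lemma ex_perfect_hash_family:
  assumes "finite X" "0 < k" "X \<noteq> {}" and t: "real k * ln (card X) * exp (real k) < real t"
  shows "\<exists>\<Phi>. perfect_hash_family k X \<Phi> \<and> card \<Phi> \<le> t"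
proof -
  define \<W> where "\<W> = {W. W \<subseteq> X \<and> card W = k}"
  have fin: "finite \<W>" using assms(1) by (simp add: \<W>_def)
  have W: "\<And>W. W \<in> \<W> \<Longrightarrow> W \<subseteq> X \<and> card W = k" by (simp add: \<W>_def)
  have n: "0 < card X" using assms by (simp add: card_gt_0_iff)
  obtain \<Phi> where \<Phi>: "\<Phi> \<subseteq> X \<rightarrow>\<^sub>E {..<k}" "finite \<Phi>" "card \<Phi> \<le> t"
    "real (card {W\<in>\<W>. \<forall>\<phi>\<in>\<Phi>. \<not> inj_on \<phi> W}) \<le> (1 - exp (- real k)) ^ t * real (card \<W>)"
    using ex_colourings_separating[OF assms(1) fin assms(2) W, of t] by blast
  \<comment> \<open>This is \<open>1 - x \<le> exp (- x)\<close> for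
    \<open>x = exp (- k)\<close>.\<close>
  have "(1 - exp (- real k)) ^ t \<le> exp (- exp (- real k)) ^ t"
    using exp_ge_add_one_self[of "- exp (- real k)"] by (intro power_mono) auto
  also have "\<dots> = exp (- exp (- real k) * real t)"
    by (metis exp_of_nat_mult mult.commute)
  also have "\<dots> < exp (- (real k * ln (card X)))"
    using t by (simp add: exp_minus field_simps)
  also have "\<dots> = 1 / real (card X) ^ k"
    using n by (simp add: exp_minus exp_of_nat_mult divide_inverse)
  finally have lt: "(1 - exp (- real k)) ^ t < 1 / real (card X) ^ k" .
  have "card \<W> = card X choose k"
    using assms(1) by (simp add: \<W>_def n_subsets)
  also have "\<dots> \<le> card X ^ k"
    by (cases "k \<le> card X") (auto simp: binomial_le_pow binomial_eq_0)
  finally have "real (card \<W>) \<le> real (card X) ^ k"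
    by (simp flip: of_nat_power)
  then have "(1 - exp (- real k)) ^ t * real (card \<W>) \<le> (1 - exp (- real k)) ^ t * real (card X) ^ k"
    by (intro mult_left_mono) auto
  also have "\<dots> < 1" using lt n by (simp add: field_simps)
  finally have "card {W\<in>\<W>. \<forall>\<phi>\<in>\<Phi>. \<not> inj_on \<phi> W} = 0"
    using \<Phi>(4) by linarith
  then have "{W\<in>\<W>. \<forall>\<phi>\<in>\<Phi>. \<not> inj_on \<phi> W} = {}" using fin by simp
  then have "\<forall>W \<subseteq> X. card W = k \<longrightarrow> (\<exists>\<phi>\<in>\<Phi>. inj_on \<phi> W)"
    unfolding \<W>_def by blast
  then show ?thesis
    unfolding perfect_hash_family_def using \<Phi>(1-3) by (intro exI[of _ \<Phi>] conjI)
qed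

subsection \<open>Matchings as walks on colour sets\<close>

text \<open>Nonempty edges matter because a nonempty set is not disjoint from itself, so a walk that
  avoids used colours cannot repeat an edge.\<close>

locale colour_coding =
  fixes E :: "'v set set" and \<Phi> :: "('v \<Rightarrow> nat) set" and k :: nat
  assumes finite_E: "finite E" and finite_colourings: "finite \<Phi>"
    and edges_nonempty: "{} \<notin> E"
    and colours: "\<And>\<phi> e. \<phi> \<in> \<Phi> \<Longrightarrow> e \<in> E \<Longrightarrow> \<phi> ` e \<subseteq> {..<k}"
begin

text \<open>A vertex \<open>(\<phi>, S)\<close> records the colouring in use and the colours already covered.\<close>

definition col_arcs :: "(('v \<Rightarrow> nat) \<times> nat set \<times> 'v set) set" where
  "col_arcs = {(\<phi>, S, e). \<phi> \<in> \<Phi> \<and> S \<subseteq> {..<k} \<and> e \<in> E \<and> \<phi> ` e \<inter> S = {}}"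

definition col_src :: "('v \<Rightarrow> nat) \<times> nat set \<times> 'v set \<Rightarrow> ('v \<Rightarrow> nat) \<times> nat set" where
  "col_src = (\<lambda>(\<phi>, S, e). (\<phi>, S))"

definition col_tgt :: "('v \<Rightarrow> nat) \<times> nat set \<times> 'v set \<Rightarrow> ('v \<Rightarrow> nat) \<times> nat set" where
  "col_tgt = (\<lambda>(\<phi>, S, e). (\<phi>, S \<union> \<phi> ` e))"

definition col_lab :: "('v \<Rightarrow> nat) \<times> nat set \<times> 'v set \<Rightarrow> 'v set" where
  "col_lab = (\<lambda>(\<phi>, S, e). e)"

lemma col_simps [simp]:
  "(\<phi>, S, e) \<in> col_arcs \<longleftrightarrow> \<phi> \<in> \<Phi> \<and> S \<subseteq> {..<k} \<and> e \<in> E \<and> \<phi> ` e \<inter> S = {}"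
  "col_src (\<phi>, S, e) = (\<phi>, S)" "col_tgt (\<phi>, S, e) = (\<phi>, S \<union> \<phi> ` e)" "col_lab (\<phi>, S, e) = e"
  by (simp_all add: col_arcs_def col_src_def col_tgt_def col_lab_def)

lemma col_arcs_subset: "col_arcs \<subseteq> \<Phi> \<times> Pow {..<k} \<times> E"
  by (auto simp: col_arcs_def)

lemma finite_col_arcs: "finite col_arcs"
  by (rule finite_subset[OF col_arcs_subset]) (simp add: finite_E finite_colourings)

lemma card_col_arcs: "card col_arcs \<le> card \<Phi> * (2 ^ k * card E)"
proof -
  have "card col_arcs \<le> card (\<Phi> \<times> Pow {..<k} \<times> E)"
    by (rule card_mono[OF _ col_arcs_subset]) (simp add: finite_E finite_colourings)
  then show ?thesis by (simp add: card_cartesian_product card_Pow)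
qed

sublocale labelled_digraph col_arcs col_src col_tgt col_lab
  by unfold_locales (rule finite_col_arcs)

lemma walk_matching:
  assumes "walk (\<phi>, S) p"
  shows "distinct (map col_lab p) \<and> set (map col_lab p) \<subseteq> E \<and> disjoint (set (map col_lab p)) \<and>
    (\<forall>e\<in>set (map col_lab p). \<phi> ` e \<inter> S = {})"
  using assms
proof (induction p arbitrary: S)
  case (Cons a p)
  then have "col_src a = (\<phi>, S)" by simp
  then obtain e where a: "a = (\<phi>, S, e)" by (cases a) auto
  from Cons.prems have e: "e \<in> E" "\<phi> ` e \<inter> S = {}" and "walk (\<phi>, S \<union> \<phi> ` e) p"
    by (auto simp: a)
  let ?M = "set (map col_lab p)"
  from Cons.IH[OF \<open>walk (\<phi>, S \<union> \<phi> ` e) p\<close>]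
  have IH: "distinct (map col_lab p)" "?M \<subseteq> E" "disjoint ?M"
    and avoid: "\<forall>f\<in>?M. \<phi> ` f \<inter> (S \<union> \<phi> ` e) = {}" by auto
  have "f \<inter> e = {}" if "f \<in> ?M" for f using avoid that by blast
  moreover from this have "e \<notin> ?M" using e(1) edges_nonempty by (metis inf.idem)
  moreover have "disjoint (insert e ?M)"
    using IH(3) \<open>\<And>f. f \<in> ?M \<Longrightarrow> f \<inter> e = {}\<close> by (auto simp: pairwise_insert disjnt_def)
  moreover have "\<forall>f\<in>?M. \<phi> ` f \<inter> S = {}" using avoid by blast
  moreover have "map col_lab (a # p) = e # map col_lab p" by (simp add: a)
  ultimately show ?case using IH e by simp
qed simp

text \<open>If the colouring is injective on the covered nodes, disjoint edges have disjoint colour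
  sets, so the edges can be traversed in any order.\<close>

lemma matching_walk:
  assumes "\<phi> \<in> \<Phi>" "S \<subseteq> {..<k}" "distinct es" "set es \<subseteq> E" "disjoint (set es)"
    "inj_on \<phi> (\<Union>(set es))" "\<forall>e\<in>set es. \<phi> ` e \<inter> S = {}"
  shows "\<exists>p. walk (\<phi>, S) p \<and> map col_lab p = es"
  using assms(2-)
proof (induction es arbitrary: S)
  case Nil
  show ?case by (rule exI[of _ "[]"]) simp
next
  case (Cons e es)
  have "\<phi> ` f \<inter> (S \<union> \<phi> ` e) = {}" if f: "f \<in> set es" for f
  proof -
    have "f \<inter> e = {}"
      using f Cons.prems(2,4) by (auto simp: pairwise_insert disjnt_def)
    then have "\<phi> ` f \<inter> \<phi> ` e = {}"
      using f Cons.prems(5) by (subst inj_on_image_Int[symmetric]) auto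
    moreover have "\<phi> ` f \<inter> S = {}" using f Cons.prems(6) by auto
    ultimately show ?thesis by blast
  qed
  moreover have "S \<union> \<phi> ` e \<subseteq> {..<k}"
    using Cons.prems(1,3) colours[OF assms(1), of e] by simp
  moreover have "inj_on \<phi> (\<Union>(set es))" using Cons.prems(5) by (rule inj_on_subset) auto
  moreover have "disjoint (set es)" using Cons.prems(4) by (simp add: pairwise_insert)
  ultimately obtain p where p: "walk (\<phi>, S \<union> \<phi> ` e) p" "map col_lab p = es"
    using Cons.IH[of "S \<union> \<phi> ` e"] Cons.prems by auto
  have "walk (\<phi>, S) ((\<phi>, S, e) # p)" "map col_lab ((\<phi>, S, e) # p) = e # es"
    using p Cons.prems assms(1) by auto
  then show ?case by (intro exI conjI)
qed

lemma walk_vec_distinct: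
  assumes "distinct (map col_lab p)"
  shows "walk_vec p = char_vec (set (map col_lab p))"
proof -
  have "walk_vec p = (\<Sum>e\<leftarrow>map col_lab p. Poly_Mapping.single e 1)"
    by (simp add: walk_vec_def comp_def)
  then show ?thesis
    using sum_list_distinct_conv_sum_set[OF assms] by (simp add: char_vec_def)
qed

text \<open>The separation hypothesis provides, for each matching, a colouring whose copy of the
  digraph contains a walk for it; conversely, walks always yield matchings.\<close>

lemma walk_vecs_eq_matchings:
  assumes "\<And>M. M \<subseteq> E \<Longrightarrow> disjoint M \<Longrightarrow> card M = l \<Longrightarrow> \<exists>\<phi>\<in>\<Phi>. inj_on \<phi> (\<Union>M)"
  shows "(\<Union>v\<in>\<Phi> \<times> {{}}. walk_vecs l v) = char_vec ` {M. M \<subseteq> E \<and> disjoint M \<and> card M = l}"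
proof (intro equalityI subsetI)
  fix x assume "x \<in> (\<Union>v\<in>\<Phi> \<times> {{}}. walk_vecs l v)"
  then obtain \<phi> p where p: "walk (\<phi>, {}) p" "length p = l" "x = walk_vec p"
    by (auto simp: walk_vecs_def)
  from walk_matching[OF p(1)] have d: "distinct (map col_lab p)"
    and M: "set (map col_lab p) \<subseteq> E" "disjoint (set (map col_lab p))" by blast+
  from d p(2) have "card (set (map col_lab p)) = l"
    by (metis distinct_card length_map)
  then show "x \<in> char_vec ` {M. M \<subseteq> E \<and> disjoint M \<and> card M = l}"
    using M walk_vec_distinct[OF d] p(3) by blast
next
  fix x assume "x \<in> char_vec ` {M. M \<subseteq> E \<and> disjoint M \<and> card M = l}"
  then obtain M where M: "M \<subseteq> E" "disjoint M" "card M = l" and x: "x = char_vec M" by blast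
  obtain es where es: "set es = M" "distinct es"
    using finite_distinct_list[of M] finite_subset[OF M(1) finite_E] by blast
  obtain \<phi> where "\<phi> \<in> \<Phi>" "inj_on \<phi> (\<Union>M)" using assms M by blast
  then obtain p where p: "walk (\<phi>, {}) p" "map col_lab p = es"
    using matching_walk[of \<phi> "{}" es] M es by auto
  have "x = walk_vec p" using walk_vec_distinct[of p] p es x by simp
  moreover have "length p = l" using p es M(3) by (metis distinct_card length_map)
  ultimately show "x \<in> (\<Union>v\<in>\<Phi> \<times> {{}}. walk_vecs l v)"
    using p(1) \<open>\<phi> \<in> \<Phi>\<close> by (auto simp: walk_vecs_def)
qed

end

lemma match_polytope_ext_form:
  assumes "0 < n" "0 < l" and t: "real (2 * l) * ln (real n) * exp (real (2 * l)) < real t"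
  obtains F where "is_ext_form_of F (complete_edges n) (match_polytope l n)"
    and "ef_size F \<le> l * (t * (2 ^ (2 * l) * card (complete_edges n)))"
    and "ef_coeffs (complete_edges n) F \<subseteq> {-1, 0, 1}"
proof -
  let ?E = "complete_edges n" and ?k = "2 * l"
  obtain \<Phi> where \<Phi>: "perfect_hash_family ?k {1..n} \<Phi>" "card \<Phi> \<le> t"
    using ex_perfect_hash_family[of "{1..n}" ?k t] assms by auto
  have finite_E: "finite ?E" by (simp add: complete_edges_def)
  have edge: "e \<subseteq> {1..n}" "card e = 2" if "e \<in> ?E" for e
    using that by (auto simp: complete_edges_def)
  interpret colour_coding ?E \<Phi> ?k
  proof
    show "{} \<notin> ?E" using edge(2)[of "{}"] by auto
    show "\<phi> ` e \<subseteq> {..<?k}" if "\<phi> \<in> \<Phi>" "e \<in> ?E" for \<phi> e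
      using \<Phi>(1) edge(1)[OF that(2)] that(1) by (auto simp: perfect_hash_family_def PiE_iff)
  qed (use \<Phi>(1) finite_E in \<open>simp_all add: perfect_hash_family_def\<close>)
  \<comment> \<open>A matching with \<open>l\<close> edges covers exactly \<open>2 * l\<close>
    nodes, the size of the sets that the hash family separates. If \<open>2 * l > n\<close>, there
    is no such matching and both polytopes are empty.\<close>
  have "\<exists>\<phi>\<in>\<Phi>. inj_on \<phi> (\<Union>M)" if M: "M \<subseteq> ?E" "disjoint M" "card M = l" for M
  proof -
    have "card (\<Union>M) = sum card M"
      using M edge by (intro card_Union_disjoint) (auto intro: finite_subset)
    also have "\<dots> = ?k" using M edge(2) by (simp add: subset_iff)
    finally show ?thesis
      using \<Phi>(1) M(1) edge(1) unfolding perfect_hash_family_def by (meson Union_least subsetD)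
  qed
  then have "convex hull (\<Union>v\<in>\<Phi> \<times> {{}}. walk_vecs l v) = match_polytope l n"
    by (simp add: walk_vecs_eq_matchings match_polytope_def matchings_def)
  moreover have "col_lab ` col_arcs \<subseteq> ?E"
    by auto
  moreover have "l * card col_arcs \<le> l * (t * (2 ^ ?k * card ?E))"
    using order_trans[OF card_col_arcs mult_le_mono1[OF \<Phi>(2)]] by (rule mult_le_mono2)
  ultimately show thesis
    using walk_polytope_ext_form[OF finite_E _ \<open>0 < l\<close>, of "\<Phi> \<times> {{}}"] that by metis
qed

section \<open>Encoding lengths and the polynomial size bound\<close>

lemma encoding_length_le_3:
  assumes "x \<in> {-1, 0, 1}"
  shows "encoding_length x \<le> 3"
proof -
  \<comment> \<open>Injectivity of \<open>of_rat\<close> resolves the definite description in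
    \<open>encoding_length\<close>.\<close>
  have "(THE r. of_rat r = (of_rat s :: real)) = s" for s
    by (rule the_equality) auto
  from this[of "-1"] this[of 0] this[of 1]
  have "(THE r. of_rat r = (- 1 :: real)) = - 1" "(THE r. of_rat r = (0 :: real)) = 0"
    "(THE r. of_rat r = (1 :: real)) = 1"
    by (simp_all add: of_rat_minus)
  then show ?thesis using assms
    by (auto simp: encoding_length_def rat_uminus_code rat_one_code rat_zero_code)
qed

text \<open>The ambient dimension is the number of edges, so bounds in terms of \<open>n\<close>
  have to be converted into bounds in terms of it.\<close>

lemma complete_edges_card_ge:
  assumes "2 \<le> n"
  shows "n \<le> 2 * card (complete_edges n)"
proof -
  have "card (complete_edges n) = n choose 2"
    by (simp add: complete_edges_def n_subsets)
  moreover have "even (n * (n - 1))" by (cases n) auto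
  then have "2 * (n choose 2) = n * (n - 1)"
    unfolding choose_two by (rule dvd_mult_div_cancel)
  moreover have "n * 1 \<le> n * (n - 1)" using assms by (intro mult_le_mono2) auto
  ultimately show ?thesis by simp
qed

text \<open>Logarithmic \<open>l\<close> makes the exponential factors polynomial:
  \<open>2 ^ (2 * l)\<close> and \<open>exp (2 * l)\<close> are at most \<open>n ^ C\<close>, as
  \<open>2 * l \<le> C * ln n\<close>. The remaining logarithms are bounded crudely by
  \<open>N\<close>.\<close>

lemma matching_size_bound:
  fixes c :: real
  assumes "0 < c" "2 \<le> n" "real n \<le> N" and l: "real l \<le> c * ln (real n)" and C: "2 * c \<le> real C"
    and t: "real t \<le> real (2 * l) * ln (real n) * exp (real (2 * l)) + 1"
  shows "real (l * (t * (2 ^ (2 * l) * m))) \<le> c * N * ((2 * c * N\<^sup>2 * N ^ C + 1) * (N ^ C * real m))"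
proof -
  have ln: "0 \<le> ln (real n)" "ln (real n) \<le> N"
    using assms(2,3) ln_le_minus_one[of "real n"] by auto
  have N: "0 \<le> N" using ln by simp
  have lN: "real l \<le> c * N"
    using l mult_left_mono[OF ln(2), of c] \<open>0 < c\<close> by linarith
  have "real (2 * l) \<le> (2 * c) * ln (real n)" using l by simp
  also have "\<dots> \<le> real C * ln (real n)" using C ln(1) by (rule mult_right_mono)
  finally have "exp (real (2 * l)) \<le> exp (real C * ln (real n))" by simp
  also have "\<dots> = real n ^ C" using assms(2) by (simp add: exp_of_nat_mult)
  also have "\<dots> \<le> N ^ C" using assms(3) by (rule power_mono) simp
  finally have e: "exp (real (2 * l)) \<le> N ^ C" .
  have "2 \<le> exp (1::real)" using exp_ge_add_one_self[of 1] by simp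
  then have "2 ^ (2 * l) \<le> exp (1::real) ^ (2 * l)" by (rule power_mono) simp
  also have "\<dots> = exp (real (2 * l))" using exp_of_nat_mult[of "2 * l" "1::real"] by simp
  finally have two: "2 ^ (2 * l) \<le> N ^ C" using e by simp
  have "real (2 * l) * ln (real n) * exp (real (2 * l)) \<le> (2 * c * N) * N * N ^ C"
    using lN ln e N \<open>0 < c\<close> by (intro mult_mono) auto
  then have tN: "real t \<le> 2 * c * N\<^sup>2 * N ^ C + 1"
    using t by (simp add: power2_eq_square mult.assoc)
  have "real l * (real t * (2 ^ (2 * l) * real m)) \<le> (c * N) * ((2 * c * N\<^sup>2 * N ^ C + 1) * (N ^ C * real m))"
    using lN tN two N \<open>0 < c\<close> by (intro mult_mono) auto
  then show ?thesis by simp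
qed

theorem corollary23:
  fixes c :: real
  assumes "c > 0"
  shows "has_compact_ext_forms
           {(complete_edges n, match_polytope l n) | n l.
              0 < n \<and> 0 < l \<and> real l \<le> c * ln (real n)}"
proof -
  define C where "C = nat \<lceil>2 * c\<rceil>"
  have C: "2 * c \<le> real C" unfolding C_def by linarith
  \<comment> \<open>The polynomial variable is the number of edges, and twice that number bounds
    \<open>n\<close>.\<close>
  define N :: "real poly" where "N = [:0, 2:]"
  \<comment> \<open>The summand 3 accommodates the encoding lengths of -1, 0 and 1, so that one
    polynomial bounds both size and coefficients.\<close>
  define b :: "real poly" where
    "b = smult c N * ((smult (2 * c) (N\<^sup>2) * N ^ C + 1) * (N ^ C * [:0, 1:])) + 3"
  have poly_b: "poly b x =
      c * (2 * x) * ((2 * c * (2 * x)\<^sup>2 * (2 * x) ^ C + 1) * ((2 * x) ^ C * x)) + 3" for x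
    by (simp add: b_def N_def mult.commute)
  have "\<exists>F. is_ext_form_of F (complete_edges n) (match_polytope l n) \<and>
      real (ef_size F) \<le> poly b (real (card (complete_edges n))) \<and>
      (\<forall>a\<in>ef_coeffs (complete_edges n) F. a \<in> \<rat> \<and>
        real (encoding_length a) \<le> poly b (real (card (complete_edges n))))"
    if pos: "0 < n" "0 < l" and l: "real l \<le> c * ln (real n)" for n l
  proof -
    let ?m = "card (complete_edges n)"
    \<comment> \<open>For \<open>n = 1\<close> the logarithm is 0, which would force
      \<open>l = 0\<close>.\<close>
    have "n \<noteq> 1" using l \<open>0 < l\<close> by auto
    then have "2 \<le> n" using \<open>0 < n\<close> by simp
    then have mN: "real n \<le> 2 * real ?m"
      using complete_edges_card_ge[of n] by linarith
    \<comment> \<open>The least natural number strictly above the threshold for a perfect hash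
      family.\<close>
    define t where "t = nat \<lfloor>real (2 * l) * ln (real n) * exp (real (2 * l))\<rfloor> + 1"
    have "0 \<le> real (2 * l) * ln (real n) * exp (real (2 * l))"
      using \<open>2 \<le> n\<close> by simp
    then have t: "real (2 * l) * ln (real n) * exp (real (2 * l)) < real t"
      "real t \<le> real (2 * l) * ln (real n) * exp (real (2 * l)) + 1"
      unfolding t_def by linarith+
    obtain F where F: "is_ext_form_of F (complete_edges n) (match_polytope l n)"
      and size: "ef_size F \<le> l * (t * (2 ^ (2 * l) * ?m))"
      and coeffs: "ef_coeffs (complete_edges n) F \<subseteq> {-1, 0, 1}"
      using match_polytope_ext_form[OF pos t(1)] by metis
    have "real (ef_size F) \<le> real (l * (t * (2 ^ (2 * l) * ?m)))"
      using size by (simp only: of_nat_le_iff)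
    also have "\<dots> \<le> poly b (real ?m) - 3"
      using matching_size_bound[OF assms \<open>2 \<le> n\<close> mN l C t(2), of ?m] by (simp add: poly_b)
    finally have size: "real (ef_size F) \<le> poly b (real ?m)" by simp
    have "3 \<le> poly b (real ?m)"
      unfolding poly_b using assms by simp
    moreover have "a \<in> \<rat> \<and> encoding_length a \<le> 3" if "a \<in> ef_coeffs (complete_edges n) F" for a
      using coeffs that encoding_length_le_3[of a] by (auto simp: subset_iff)
    ultimately show ?thesis using F size by (fastforce intro: order_trans)
  qed
  \<comment> \<open>The bivariate polynomial \<open>[:b:]\<close> is constant in the vertex encoding
    length: the bound depends on the dimension alone.\<close>
  then show ?thesis
    unfolding has_compact_ext_forms_def by (intro exI[of _ "[:b:]"]) (auto simp: Let_def)
qed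

end
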